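(* Let $0 \le p \le 1$ and let $n$ be even. Inserting the converging sequence $1, n, 2, n-1, 3, n-2, \ldots, n/2, n/2+1$ into an initially empty binary search tree, applying \textsc{RebalanceZig} after each insertion, results in a binary search tree whose expected average node depth is $\Theta(n)$.
   Context: Each new element is first placed as a new leaf $v$ at its standard unbalanced BST position, and then \textsc{RebalanceZig}$(v)$ is applied: while $v$ has a parent and an independent coin flip shows tail (tail has probability $p$, head probability $1-p$), set $v\gets$ parent of $v$; afterwards, if $v$ has a parent, rotate $v$ up (the standard single rotation at the parent of $v$ that moves $v$ one level up). The depth of a node is the number of edges from it to the root; the average node depth is the sum of depths of all $n$ nodes divided by $n$. Expectation is over the coin flips. *)

theory Defs
  imports "HOL-Probability.Probability" "HOL-Library.Tree" "HOL-Library.Landau_Symbols"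
begin

datatype dir = Lft | Rgt

text \<open>A node is identified by its address, the list of directions leading from the root to it.
  Thus the root is the empty list, the parent of a non-root node \<open>v\<close> is \<open>butlast v\<close>, and the depth
  of \<open>v\<close> is \<open>length v\<close>.\<close>

fun nodes :: "'a tree \<Rightarrow> dir list set" where
  "nodes Leaf = {}"
| "nodes (Node l x r) = insert [] ((#) Lft ` nodes l \<union> (#) Rgt ` nodes r)"

definition avg_depth :: "'a tree \<Rightarrow> real" where
  "avg_depth t = (\<Sum>v\<in>nodes t. real (length v)) / real (card (nodes t))"

fun bst_insert :: "'a::linorder \<Rightarrow> 'a tree \<Rightarrow> 'a tree" where
  "bst_insert x Leaf = Node Leaf x Leaf"
| "bst_insert x (Node l a r) =
     (if x < a then Node (bst_insert x l) a r else Node l a (bst_insert x r))"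

text \<open>The address at which \<open>bst_insert x t\<close> places the new leaf.\<close>

fun leaf_pos :: "'a::linorder \<Rightarrow> 'a tree \<Rightarrow> dir list" where
  "leaf_pos x Leaf = []"
| "leaf_pos x (Node l a r) = (if x < a then Lft # leaf_pos x l else Rgt # leaf_pos x r)"

text \<open>\<open>rotate_up v t\<close> performs the single rotation at the parent of \<open>v\<close> that moves \<open>v\<close> one level up.\<close>

fun rotate_up :: "dir list \<Rightarrow> 'a tree \<Rightarrow> 'a tree" where
  "rotate_up [Lft] (Node (Node a x b) y c) = Node a x (Node b y c)"
| "rotate_up [Rgt] (Node a x (Node b y c)) = Node (Node a x b) y c"
| "rotate_up (Lft # d # v) (Node l x r) = Node (rotate_up (d # v) l) x r"
| "rotate_up (Rgt # d # v) (Node l x r) = Node l x (rotate_up (d # v) r)"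
| "rotate_up v t = t"

text \<open>The outcome \<open>True\<close> of the coin is tail, which has probability \<open>p\<close>.\<close>

function climb :: "real \<Rightarrow> dir list \<Rightarrow> dir list pmf" where
  "climb p v =
     (if v = [] then return_pmf v
      else bernoulli_pmf p \<bind> (\<lambda>tail. if tail then climb p (butlast v) else return_pmf v))"
  by auto
termination
  by (relation "Wellfounded.measure (\<lambda>(p, v). length v)") auto

declare climb.simps [simp del]

definition rebalance_zig :: "real \<Rightarrow> dir list \<Rightarrow> 'a tree \<Rightarrow> 'a tree pmf" where
  "rebalance_zig p v t = map_pmf (\<lambda>u. if u = [] then t else rotate_up u t) (climb p v)"

definition insert_zig :: "real \<Rightarrow> 'a::linorder \<Rightarrow> 'a tree \<Rightarrow> 'a tree pmf" where
  "insert_zig p x t = rebalance_zig p (leaf_pos x t) (bst_insert x t)"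

fun insert_seq_zig :: "real \<Rightarrow> 'a::linorder list \<Rightarrow> 'a tree \<Rightarrow> 'a tree pmf" where
  "insert_seq_zig p [] t = return_pmf t"
| "insert_seq_zig p (x # xs) t = insert_zig p x t \<bind> insert_seq_zig p xs"

definition converging_seq :: "nat \<Rightarrow> nat list" where
  "converging_seq n = concat (map (\<lambda>i. [i, n + 1 - i]) [1..<n div 2 + 1])"

definition expected_avg_depth :: "real \<Rightarrow> nat \<Rightarrow> real" where
  "expected_avg_depth p n =
     measure_pmf.expectation (insert_seq_zig p (converging_seq n) Leaf) avg_depth"

lemma finite_nodes [simp]: "finite (nodes t)"
  by (induction t) auto

lemma card_nodes: "card (nodes t) = size t"
proof (induction t)
  case (Node l x r)
  have "card ((#) Lft ` nodes l \<union> (#) Rgt ` nodes r) = size l + size r"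
    by (subst card_Un_disjoint) (auto simp: card_image Node)
  then show ?case by (simp add: card_insert_if image_iff)
qed simp

lemma sum_depth_nodes: "(\<Sum>v\<in>nodes t. length v) = ipl t"
proof (induction t)
  case (Node l x r)
  have "(\<Sum>v\<in>(#) Lft ` nodes l \<union> (#) Rgt ` nodes r. length v)
      = (\<Sum>v\<in>nodes l. Suc (length v)) + (\<Sum>v\<in>nodes r. Suc (length v))"
    by (subst sum.union_disjoint) (auto simp: sum.reindex)
  also have "\<dots> = ipl l + size l + ipl r + size r"
    using Node by (simp add: sum_Suc card_nodes)
  finally show ?case by (simp add: sum.insert_if image_iff)
qed simp

lemma nodes_bst_insert: "nodes (bst_insert x t) = insert (leaf_pos x t) (nodes t)"
  by (induction t) auto

lemma leaf_pos_notin_nodes: "leaf_pos x t \<notin> nodes t"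
  by (induction t) auto

lemma finite_set_climb: "finite (set_pmf (climb p v))"
  by (induction p v rule: climb.induct) (subst climb.simps, auto)

lemma finite_set_insert_seq_zig: "finite (set_pmf (insert_seq_zig p xs t))"
  by (induction xs arbitrary: t)
     (auto simp: insert_zig_def rebalance_zig_def finite_set_climb)

end

theory Submission imports Defs begin

text \<open>
  The linear lower bound holds for every outcome of the coin flips. All insertions happen in one
  gap between the smaller and the larger half of the keys; let \<open>W\<close> be the path to this gap. An
  insertion appends one direction to \<open>W\<close>, alternately \<open>Rgt\<close> and \<open>Lft\<close>. A rotation on the path
  transposes two adjacent directions if they differ and merges them into one if they agree. A merge
  removes a pair of equal neighbours and a transposition creates at most two of them, so at most two
  thirds of the insertions can fail to lengthen \<open>W\<close>: the path has length at least \<open>n / 3\<close>, and the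
  depths of the nodes on it add up to a quadratic amount.
\<close>

fun opposite :: "dir \<Rightarrow> dir" where
  "opposite Lft = Rgt"
| "opposite Rgt = Lft"

lemma opposite_neq [simp]: "opposite d \<noteq> d" "d \<noteq> opposite d"
  by (cases d; simp)+

fun equal_adj :: "'a list \<Rightarrow> nat" where
  "equal_adj (x # y # zs) = of_bool (x = y) + equal_adj (y # zs)"
| "equal_adj _ = 0"

lemma equal_adj_Cons: "equal_adj (x # xs) = of_bool (xs \<noteq> [] \<and> x = hd xs) + equal_adj xs"
  by (cases xs) auto

lemma equal_adj_append:
  "equal_adj (xs @ ys) =
     equal_adj xs + equal_adj ys + of_bool (xs \<noteq> [] \<and> ys \<noteq> [] \<and> last xs = hd ys)"
  by (induction xs) (auto simp: equal_adj_Cons hd_append)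

lemma equal_adj_merge: "equal_adj (as @ [a, a] @ bs) = Suc (equal_adj (as @ [a] @ bs))"
  by (simp add: equal_adj_append equal_adj_Cons)

text \<open>Only the two pairs joining the swapped entries to \<open>as\<close> and
  \<open>bs\<close> can change.\<close>

lemma equal_adj_transpose: "equal_adj (as @ [b, a] @ bs) \<le> equal_adj (as @ [a, b] @ bs) + 2"
  by (simp add: equal_adj_append equal_adj_Cons)

text \<open>The rotated node is an ancestor of the new leaf or that leaf itself, so it lies on the
  path to the gap whatever the coins show.\<close>

lemma prefix_climb: "u \<in> set_pmf (climb p v) \<Longrightarrow> \<exists>s. v = u @ s"
proof (induction v rule: length_induct)
  case (1 v)
  show ?case
  proof (cases "v = []")
    case True
    then show ?thesis using "1.prems" by (simp add: climb.simps)
  next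
    case False
    then have "u \<in> set_pmf (climb p (butlast v)) \<or> u = v"
      using "1.prems" by (subst (asm) climb.simps) (auto split: if_splits)
    then show ?thesis
    proof
      assume "u \<in> set_pmf (climb p (butlast v))"
      then obtain s where "butlast v = u @ s" using "1.IH" False by force
      then have "v = u @ s @ [last v]"
        by (metis False append_assoc append_butlast_last_id)
      then show ?thesis by blast
    qed simp
  qed
qed

lemma size_bst_insert: "size (bst_insert x t) = Suc (size t)"
  by (induction t) auto

lemma size_rotate_up: "size (rotate_up v t) = size t"
  by (induction v t rule: rotate_up.induct) auto

lemma leaf_pos_bst_insert:
  "leaf_pos y t = leaf_pos x t \<Longrightarrow>
    leaf_pos y (bst_insert x t) = leaf_pos x t @ [if y < x then Lft else Rgt]"
  by (induction t) (auto split: if_splits)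

text \<open>If \<open>a = b\<close>, the search for \<open>y\<close> leaves the rotated node on its
  outer side and afterwards skips its old parent. Otherwise it enters the middle subtree and meets
  the two nodes in reverse order.\<close>

lemma leaf_pos_rotate_up:
  "leaf_pos y t = as @ [a, b] @ bs \<Longrightarrow>
    leaf_pos y (rotate_up (as @ [a]) t) = as @ (if a = b then [a] else [b, a]) @ bs"
proof (induction as arbitrary: t)
  case Nil
  then obtain l x r where t: "t = Node l x r" by (cases t) auto
  show ?case
  proof (cases a)
    case Lft
    with Nil t obtain l1 x1 r1 where "l = Node l1 x1 r1"
      by (cases l) (auto split: if_splits)
    with Lft Nil t show ?thesis by (auto split: if_splits)
  next
    case Rgt
    with Nil t obtain l1 x1 r1 where "r = Node l1 x1 r1"
      by (cases r) (auto split: if_splits)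
    with Rgt Nil t show ?thesis by (auto split: if_splits)
  qed
next
  case (Cons c as)
  then obtain l x r where t: "t = Node l x r" by (cases t) auto
  \<comment> \<open>\<open>rotate_up\<close> recurses only while two directions remain.\<close>
  obtain d v where dv: "as @ [a] = d # v" by (cases as) auto
  have "leaf_pos y (rotate_up (d # v) (if c = Lft then l else r))
      = as @ (if a = b then [a] else [b, a]) @ bs"
    unfolding dv[symmetric] using Cons t by (intro Cons.IH) (auto split: if_splits)
  then show ?case using Cons.prems t dv by (cases c) (auto split: if_splits)
qed

text \<open>\<open>G\<close> is the gap, and \<open>d\<close> the direction that the next insertion appends to the path.\<close>

definition long_gap_path :: "'a::linorder set \<Rightarrow> dir \<Rightarrow> 'a tree \<Rightarrow> bool" where
  "long_gap_path G d t \<longleftrightarrow>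
     (\<exists>W. (\<forall>y\<in>G. leaf_pos y t = W) \<and> size t + equal_adj (W @ [d]) \<le> 3 * length W)"

lemma size_insert_zig: "t' \<in> set_pmf (insert_zig p x t) \<Longrightarrow> size t' = Suc (size t)"
  by (auto simp: insert_zig_def rebalance_zig_def size_rotate_up size_bst_insert)

text \<open>The size grows by 1. A merge pays for this with one equal pair; otherwise the path grows
  by 1, and the factor 3 covers the new node and up to two new equal pairs.\<close>

lemma long_gap_path_insert_zig:
  assumes t': "t' \<in> set_pmf (insert_zig p x t)"
    and path: "long_gap_path G d t"
    and G: "x \<in> G" "G' \<subseteq> G" "\<And>y. y \<in> G' \<Longrightarrow> y < x \<longleftrightarrow> d = Lft"
  shows "long_gap_path G' (opposite d) t'"
proof -
  obtain W where W: "\<And>y. y \<in> G \<Longrightarrow> leaf_pos y t = W"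
    and le: "size t + equal_adj (W @ [d]) \<le> 3 * length W"
    using path unfolding long_gap_path_def by blast
  have ins: "leaf_pos y (bst_insert x t) = W @ [d]" if "y \<in> G'" for y
    using leaf_pos_bst_insert[of y t x] W G that by (cases d) auto
  have size: "size t' = Suc (size t)"
    using t' by (rule size_insert_zig)
  from t' obtain u where u: "u \<in> set_pmf (climb p W)"
    and t'_eq: "t' = (if u = [] then bst_insert x t else rotate_up u (bst_insert x t))"
    unfolding insert_zig_def rebalance_zig_def using W[OF G(1)] by auto
  \<comment> \<open>Since directions alternate, announcing the next one creates no equal
    pair.\<close>
  have eq: "equal_adj (W @ [d] @ [opposite d]) = equal_adj (W @ [d])"
    by (simp add: equal_adj_append)
  show ?thesis
  proof (cases "u = []")
    case True
    then show ?thesis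
      unfolding long_gap_path_def using ins size le eq t'_eq
      by (intro exI[of _ "W @ [d]"]) simp
  next
    case False
    then obtain as a where u_eq: "u = as @ [a]" by (metis rev_exhaust)
    obtain s where s: "W = u @ s" using prefix_climb[OF u] by blast
    \<comment> \<open>If the new leaf itself is rotated, \<open>s\<close> is empty and
      \<open>b\<close> is \<open>d\<close>.\<close>
    obtain b bs where bs: "s @ [d] = b # bs" by (cases "s @ [d]") auto
    have V: "W @ [d] = as @ [a, b] @ bs" using s bs u_eq by simp
    define V' where "V' = as @ (if a = b then [a] else [b, a]) @ bs"
    have pos: "leaf_pos y t' = V'" if "y \<in> G'" for y
      using leaf_pos_rotate_up[of y "bst_insert x t" as a b bs] ins[OF that] V False t'_eq u_eq
      by (simp add: V'_def)
    have eq': "equal_adj (as @ [a, b] @ bs @ [opposite d]) = equal_adj (W @ [d])"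
      using eq V by (metis append_assoc)
    have len: "Suc (length W) = length as + 2 + length bs"
      using arg_cong[OF V, of length] by simp
    have "Suc (size t) + equal_adj (V' @ [opposite d]) \<le> 3 * length V'"
    proof (cases "a = b")
      case True
      then show ?thesis
        using equal_adj_merge[of as a "bs @ [opposite d]"] eq' len le
        by (simp add: V'_def)
    next
      case False
      then show ?thesis
        using equal_adj_transpose[of as b a "bs @ [opposite d]"] eq' len le
        by (simp add: V'_def)
    qed
    then show ?thesis unfolding long_gap_path_def using pos size by auto
  qed
qed

lemma set_pmf_insert_seq_zig_append:
  "set_pmf (insert_seq_zig p (xs @ ys) t) =
     (\<Union>s\<in>set_pmf (insert_seq_zig p xs t). set_pmf (insert_seq_zig p ys s))"
  by (induction xs arbitrary: t) auto

text \<open>Since \<open>leaf_pos\<close> sends a key equal to a label to the right, the largest of the small keys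
  still leads to the gap; it is included in the interval below to keep that nonempty until the end.\<close>

lemma long_gap_path_converging_prefix:
  assumes "j \<le> n div 2"
    and "t \<in> set_pmf (insert_seq_zig p (concat (map (\<lambda>i. [i, n + 1 - i]) [1..<j + 1])) Leaf)"
  shows "size t = 2 * j \<and> long_gap_path {j..n - j} Rgt t"
  using assms
proof (induction j arbitrary: t)
  case 0
  then show ?case by (auto simp: long_gap_path_def intro!: exI[of _ "[]"])
next
  case (Suc j)
  let ?pre = "concat (map (\<lambda>i. [i, n + 1 - i]) [1..<j + 1])"
  have "concat (map (\<lambda>i. [i, n + 1 - i]) [1..<Suc j + 1]) = ?pre @ [Suc j, n - j]"
    by simp
  with Suc.prems(2) obtain r s where r: "r \<in> set_pmf (insert_seq_zig p ?pre Leaf)"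
    and s: "s \<in> set_pmf (insert_zig p (Suc j) r)"
    and t: "t \<in> set_pmf (insert_zig p (n - j) s)"
    by (auto simp: set_pmf_insert_seq_zig_append simp del: upt_Suc)
  have IH: "size r = 2 * j" "long_gap_path {j..n - j} Rgt r"
    using Suc.IH[OF _ r] Suc.prems(1) by auto
  have "long_gap_path {Suc j..n - j} (opposite Rgt) s"
    using Suc.prems(1) by (intro long_gap_path_insert_zig[OF s IH(2)]) auto
  \<comment> \<open>Unlike \<open>Suc j\<close>, the key \<open>n - j\<close> must leave the
    interval: searching for it again would turn right, not left.\<close>
  then have "long_gap_path {Suc j..n - Suc j} (opposite (opposite Rgt)) t"
    using Suc.prems(1) by (intro long_gap_path_insert_zig[OF t]) auto
  then show ?case
    using size_insert_zig[OF s] size_insert_zig[OF t] IH(1) by simp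
qed

lemma length_leaf_pos_le_size: "length (leaf_pos y t) \<le> size t"
  by (induction t) auto

text \<open>A search path of length \<open>L\<close> visits nodes at depths 0 to
  \<open>L - 1\<close>, whose sum is \<open>L * (L - 1) / 2\<close>.\<close>

lemma ipl_ge_leaf_pos:
  "length (leaf_pos y t) * length (leaf_pos y t) \<le> 2 * ipl t + length (leaf_pos y t)"
proof (induction t)
  case (Node l a r)
  then show ?case
    using length_leaf_pos_le_size[of y l] length_leaf_pos_le_size[of y r] by auto
qed simp

lemma ipl_le_size_squared: "ipl t \<le> size t * size t"
  by (induction t) (auto simp: algebra_simps)

lemma avg_depth_eq: "avg_depth t = real (ipl t) / real (size t)"
  by (simp add: avg_depth_def card_nodes flip: sum_depth_nodes)

lemma avg_depth_le_size: "avg_depth t \<le> real (size t)"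
proof (cases "size t = 0")
  case False
  have "real (ipl t) \<le> real (size t) * real (size t)"
    using ipl_le_size_squared[of t] by (metis of_nat_le_iff of_nat_mult)
  then show ?thesis using False by (simp add: avg_depth_eq divide_simps)
qed (simp add: avg_depth_eq)

lemma avg_depth_converging_bounds:
  assumes "even n" "n \<ge> 6" "t \<in> set_pmf (insert_seq_zig p (converging_seq n) Leaf)"
  shows "real n / 36 \<le> avg_depth t" "avg_depth t \<le> real n"
proof -
  define k where "k = n div 2"
  have n: "n = 2 * k" using assms(1) by (simp add: k_def)
  have t: "size t = n" "long_gap_path {k..n - k} Rgt t"
    using long_gap_path_converging_prefix[of k n t p] assms(3) n
    by (auto simp: converging_seq_def)
  define P where "P = real (length (leaf_pos k t))"
  have P: "real n / 3 \<le> P"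
    using t n by (auto simp: long_gap_path_def P_def)
  have "P * P \<le> 2 * real (ipl t) + P"
    using ipl_ge_leaf_pos[of k t]
    unfolding P_def by (metis of_nat_le_iff of_nat_add of_nat_mult of_nat_numeral)
  \<comment> \<open>Here \<open>n \<ge> 6\<close> gives \<open>n / 3 - 1 \<ge> n / 6\<close>;
    halving the product yields the constant 1/36.\<close>
  moreover have "real n / 3 * (real n / 6) \<le> P * (P - 1)"
    using P assms(2) by (intro mult_mono) auto
  ultimately have "real n * real n / 36 \<le> real (ipl t)"
    by (simp add: algebra_simps)
  then show "real n / 36 \<le> avg_depth t"
    using assms(2) t(1) by (simp add: avg_depth_eq divide_simps)
  show "avg_depth t \<le> real n"
    using avg_depth_le_size[of t] t(1) by simp
qed

lemma expected_avg_depth_bounds: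
  assumes "even n" "n \<ge> 6"
  shows "real n / 36 \<le> expected_avg_depth p n" "expected_avg_depth p n \<le> real n"
proof -
  have int: "integrable (measure_pmf (insert_seq_zig p (converging_seq n) Leaf)) avg_depth"
    by (intro integrable_measure_pmf_finite finite_set_insert_seq_zig)
  show "real n / 36 \<le> expected_avg_depth p n"
    unfolding expected_avg_depth_def
    by (intro measure_pmf.integral_ge_const int AE_pmfI avg_depth_converging_bounds(1) assms)
  show "expected_avg_depth p n \<le> real n"
    unfolding expected_avg_depth_def
    by (intro measure_pmf.integral_le_const int AE_pmfI avg_depth_converging_bounds(2) assms)
qed

theorem theorem3:
  shows "(\<lambda>(p, n). expected_avg_depth p n)
    \<in> \<Theta>[principal {0..1} \<times>\<^sub>F inf sequentially (principal {n. even n})](\<lambda>(p, n). real n)"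
proof -
  let ?F = "principal {0..1::real} \<times>\<^sub>F inf sequentially (principal {n::nat. even n})"
  \<comment> \<open>The threshold 6 is independent of \<open>p\<close>, as are the constants 1 and
    1/36 below, so the estimate is uniform in \<open>p\<close>.\<close>
  have ev: "eventually (\<lambda>(p, n). even n \<and> n \<ge> 6) ?F"
    unfolding eventually_prod_filter eventually_principal eventually_inf_principal
    by (intro exI[of _ "\<lambda>_. True"] exI[of _ "\<lambda>n. even n \<and> n \<ge> 6"] conjI
          eventually_mono[OF eventually_ge_at_top[of 6]]) auto
  show ?thesis
  proof (rule bigthetaI)
    show "(\<lambda>(p, n). expected_avg_depth p n) \<in> O[?F](\<lambda>(p, n). real n)"
    proof (rule bigoI[of _ 1], rule eventually_mono[OF ev], clarify)
      fix p :: real and n :: nat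
      assume "even n" "6 \<le> n"
      then show "norm (expected_avg_depth p n) \<le> 1 * norm (real n)"
        using expected_avg_depth_bounds[of n p] by simp
    qed
    show "(\<lambda>(p, n). expected_avg_depth p n) \<in> \<Omega>[?F](\<lambda>(p, n). real n)"
    proof (rule landau_omega.bigI[of "1 / 36"], simp, rule eventually_mono[OF ev], clarify)
      fix p :: real and n :: nat
      assume "even n" "6 \<le> n"
      then show "1 / 36 * norm (real n) \<le> norm (expected_avg_depth p n)"
        using expected_avg_depth_bounds[of n p] by simp
    qed
  qed
qed

end
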